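(* Let $T_{v_i}$ be a finite tree with root $v_i$ and edge set $E$, in which every link $e\in E$ carries a positive weight $w_{\mathrm{trans}}(e)>0$ (its transfer delay). Let $w(T_{v_i})$ denote the synchronization delay of $T_{v_i}$ under the aggregate-forward transmission mode with negligible processing delays. Then $$w(T_{v_i})=\max_{p_l\in\mathcal{P}(T_{v_i})}\ \sum_{e\in p_l} w_{\mathrm{trans}}(e),$$ where $\mathcal{P}(T_{v_i})$ is the set of all paths in $T_{v_i}$ from a leaf to the root $v_i$.
   Context: Aggregate-forward mode on a rooted tree: all links are oriented toward the root. The nodes hold model data that is to be aggregated at the root. All leaves start sending to their parents at time $0$. A non-leaf node must wait until the data of all of its child nodes has arrived; it then aggregates this data (together with its own) and, if it is not the root, forwards the result to its parent. Transmission over a link $e$ takes time $w_{\mathrm{trans}}(e)$. Processing (aggregation) delays are neglected, i.e. taken to be $0$. Formally, define the ready time $D(v)$ of a node $v$ by $D(v)=0$ if $v$ is a leaf, and otherwise $$D(v)=\max_{c\text{ child of }v}\bigl(D(c)+w_{\mathrm{trans}}(e_{c,v})\bigr),$$ where $e_{c,v}$ is the link from $c$ to its parent $v$. The time $D(v)-\bigl(D(c)+w_{\mathrm{trans}}(e_{c,v})\bigr)\ge 0$ for which data coming from the child $c$ waits at $v$ for slower children of $v$ is the blockage delay at $v$ along a path passing through $c$ and $v$. The delay of a leaf-to-root path is the sum of the transfer delays of its links plus the blockage delays at its non-leaf nodes. The synchronization delay $w(T_{v_i})$ of the tree is the time at which the root has received the data from all of its children, i.e. $w(T_{v_i})=D(v_i)$.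 A leaf is a node with no children; if the tree consists of the root alone, the root is its only leaf, the only path is the trivial one, and the empty sum is $0$. *)

theory Defs
  imports "Graph_Theory.Graph_Theory"
begin

text \<open>
  Finite rooted trees whose arcs are oriented toward the root: in-arborescences, i.e. from every
  vertex there is exactly one directed walk to the root. The predicate \<open>tree\<close> of
  \<open>Graph_Theory\<close> is not suitable here: on a digraph that is not symmetric it only excludes
  directed cycles, and on a symmetric one it excludes every edge.
\<close>

locale in_tree = fin_digraph T for T :: "('a, 'b) pre_digraph" +
  fixes root :: 'a
  assumes root_in_verts: "root \<in> verts T"
    and unique_awalk: "v \<in> verts T \<Longrightarrow> \<exists>!p. awalk v p root"
begin

lemma no_closed_awalk:
  assumes "awalk v p v" shows "p = []"
proof -
  have "v \<in> verts T" using assms by (rule awalk_hd_in_verts)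
  then obtain q where q: "awalk v q root" using unique_awalk by blast
  with assms have "awalk v (p @ q) root" by (rule awalk_appendI)
  with q \<open>v \<in> verts T\<close> have "p @ q = q" using unique_awalk by blast
  then show ?thesis by simp
qed

lemma acyclic_arcs_ends: "acyclic (arcs_ends T)"
proof (rule acyclicI, intro allI notI)
  fix v assume "(v, v) \<in> (arcs_ends T)\<^sup>+"
  then obtain p where "awalk v p v" "p \<noteq> []" by (auto simp: reachable1_awalk)
  then show False using no_closed_awalk by blast
qed

lemma wf_arcs_ends: "wf (arcs_ends T)"
  using acyclic_arcs_ends finite_arcs by (intro finite_acyclic_wf) (auto simp: arcs_ends_def)

text \<open>
  The children of \<open>v\<close> are the tails of the arcs entering \<open>v\<close>, so that a leaf is a vertex
  without entering arcs; the root is a leaf exactly if it is the only vertex.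
\<close>

definition leaf :: "'a \<Rightarrow> bool" where
  "leaf v \<longleftrightarrow> v \<in> verts T \<and> in_arcs T v = {}"

function ready_time :: "('b \<Rightarrow> real) \<Rightarrow> 'a \<Rightarrow> real" where
  "ready_time w v =
     (if in_arcs T v = {} then 0
      else MAX e\<in>in_arcs T v. ready_time w (tail T e) + w e)"
  by pat_completeness auto
termination
proof (relation "inv_image (arcs_ends T) snd")
  show "wf (inv_image (arcs_ends T) (snd :: ('b \<Rightarrow> real) \<times> 'a \<Rightarrow> 'a))"
    using wf_arcs_ends by (rule wf_inv_image)
qed (auto simp: in_arcs_def arcs_ends_conv)

declare ready_time.simps [simp del]

definition sync_delay :: "('b \<Rightarrow> real) \<Rightarrow> real" where
  "sync_delay w = ready_time w root"

text \<open>
  A path is represented by its list of arcs. This loses nothing: the starting vertex of a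
  nonempty path is the tail of its first arc, and the empty list can only stand for the
  trivial path at the root, which is included only if the root is a leaf.
\<close>

definition leaf_root_paths :: "'b awalk set" where
  "leaf_root_paths = {p. \<exists>l. leaf l \<and> apath l p root}"

lemma finite_leaf_root_paths: "finite leaf_root_paths"
proof -
  have "leaf_root_paths \<subseteq> (\<Union>l\<in>verts T. {p. apath l p root})"
    by (auto simp: leaf_root_paths_def leaf_def)
  moreover have "finite (\<Union>l\<in>verts T. {p. apath l p root})"
    by (intro finite_UN_I finite_verts apaths_finite)
  ultimately show ?thesis by (rule finite_subset)
qed

lemma leaf_root_paths_nonempty: "leaf_root_paths \<noteq> {}"
proof -
  obtain l where l: "l \<in> verts T" and min: "\<And>u. (u, l) \<in> arcs_ends T \<Longrightarrow> u \<notin> verts T"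
    using wfE_min[OF wf_arcs_ends root_in_verts] by blast
  have "leaf l"
    using l min by (fastforce simp: leaf_def in_arcs_def arcs_ends_conv)
  moreover obtain p where "awalk l p root" using unique_awalk[OF l] by blast
  then have "apath l (awalk_to_apath p) root" by (rule apath_awalk_to_apath)
  ultimately show ?thesis by (auto simp: leaf_root_paths_def)
qed

end

end

theory Submission
  imports Defs
begin

text \<open>Along a path from a leaf to the root, transfer delays and nonnegative blockage delays
  add up to the ready time of the root, so the transfer delays alone sum to at most
  \<open>ready_time w root\<close> (\<open>awalk_from_leaf_le_ready_time\<close>). Conversely,
  descend from the root, always to a slowest child: no blockage occurs, acyclicity makes the descent
  end in a leaf, and the resulting path attains the bound (\<open>ready_time_attained\<close>). Both
  facts are proved for walks into an arbitrary vertex, so that induction applies;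
  \<open>apath_root_iff_awalk\<close> then returns to paths at the root.\<close>

context in_tree
begin

lemma ready_time_leaf: "leaf v \<Longrightarrow> ready_time w v = 0"
  by (simp add: leaf_def ready_time.simps)

lemma ready_time_in_arcs:
  "in_arcs T v \<noteq> {} \<Longrightarrow> ready_time w v = (MAX e\<in>in_arcs T v. ready_time w (tail T e) + w e)"
  by (subst ready_time.simps) simp

text \<open>The walk is peeled from its end, because \<open>ready_time\<close> at \<open>v\<close>
  recurses over the arcs entering \<open>v\<close>: the last arc is one of the candidates in that
  maximum.\<close>

lemma awalk_from_leaf_le_ready_time:
  assumes "leaf l" and "awalk l p v"
  shows "(\<Sum>e\<leftarrow>p. w e) \<le> ready_time w v"
  using assms(2)
proof (induction p arbitrary: v rule: rev_induct)
  case Nil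
  then have "v = l" by (simp add: awalk_Nil_iff)
  with \<open>leaf l\<close> show ?case by (simp add: ready_time_leaf)
next
  case (snoc e p)
  then have p: "awalk l p (tail T e)" and e: "e \<in> in_arcs T v"
    by (auto simp: awalk_simps)
  have "(\<Sum>e\<leftarrow>p @ [e]. w e) \<le> ready_time w (tail T e) + w e"
    using snoc.IH[OF p] by simp
  also have "\<dots> \<le> (MAX e\<in>in_arcs T v. ready_time w (tail T e) + w e)"
    using e by (intro Max_ge) auto
  also have "\<dots> = ready_time w v"
    using e by (subst ready_time_in_arcs) auto
  finally show ?case .
qed

lemma ready_time_attained:
  assumes "v \<in> verts T"
  shows "\<exists>l p. leaf l \<and> awalk l p v \<and> (\<Sum>e\<leftarrow>p. w e) = ready_time w v"
  using wf_arcs_ends assms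
proof (induction v rule: wf_induct_rule)
  case (less v)
  show ?case
  proof (cases "in_arcs T v = {}")
    case True
    with less.prems have "leaf v" "awalk v [] v"
      by (auto simp: leaf_def awalk_Nil_iff)
    moreover have "(\<Sum>e\<leftarrow>[]. w e) = ready_time w v"
      using \<open>leaf v\<close> by (simp add: ready_time_leaf)
    ultimately show ?thesis by blast
  next
    case False
    \<comment> \<open>A maximum over a finite nonempty set is attained; the arc \<open>e\<close>
      obtained comes from a slowest child, whose data is not blocked at \<open>v\<close>.\<close>
    have "ready_time w v \<in> (\<lambda>e. ready_time w (tail T e) + w e) ` in_arcs T v"
      unfolding ready_time_in_arcs[OF False] using False by (intro Max_in) auto
    then obtain e where e: "e \<in> in_arcs T v"
      and max: "ready_time w v = ready_time w (tail T e) + w e" by blast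
    then have arc: "(tail T e, v) \<in> arcs_ends T" "tail T e \<in> verts T"
      using e by (auto simp: arcs_ends_conv)
    obtain l p where p: "leaf l" "awalk l p (tail T e)"
      "(\<Sum>e\<leftarrow>p. w e) = ready_time w (tail T e)"
      using less.IH[OF arc] by blast
    have "awalk (tail T e) [e] v"
      using e less.prems by (simp add: awalk_simps)
    with p(2) have "awalk l (p @ [e]) v" by (rule awalk_appendI)
    moreover have "(\<Sum>e\<leftarrow>p @ [e]. w e) = ready_time w v"
      using p(3) max by simp
    ultimately show ?thesis using p(1) by blast
  qed
qed

text \<open>Shortening a walk to a path keeps its ends, so uniqueness of walks to the root forces
  the shortened walk to be the walk itself.\<close>

lemma apath_root_iff_awalk: "apath v p root \<longleftrightarrow> awalk v p root"
proof
  assume p: "awalk v p root"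
  then have "apath v (awalk_to_apath p) root" by (rule apath_awalk_to_apath)
  moreover have "awalk_to_apath p = p"
    using unique_awalk[OF awalk_hd_in_verts[OF p]] awalkI_apath[OF calculation] p by blast
  ultimately show "apath v p root" by simp
qed (rule awalkI_apath)

theorem sync_delay_eq_Max_leaf_root_paths:
  "sync_delay w = (MAX p\<in>leaf_root_paths. \<Sum>e\<leftarrow>p. w e)"
  unfolding sync_delay_def
proof (rule sym, rule Max_eqI)
  show "finite ((\<lambda>p. \<Sum>e\<leftarrow>p. w e) ` leaf_root_paths)"
    by (intro finite_imageI finite_leaf_root_paths)
  show "s \<le> ready_time w root" if "s \<in> (\<lambda>p. \<Sum>e\<leftarrow>p. w e) ` leaf_root_paths" for s
    using that awalk_from_leaf_le_ready_time
    by (auto simp: leaf_root_paths_def apath_root_iff_awalk)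
  show "ready_time w root \<in> (\<lambda>p. \<Sum>e\<leftarrow>p. w e) ` leaf_root_paths"
    using ready_time_attained[OF root_in_verts, of w]
    by (force simp: leaf_root_paths_def apath_root_iff_awalk)
qed

end

theorem theorem1:
  fixes T :: "('a, 'b) pre_digraph" and root :: 'a and w :: "'b \<Rightarrow> real"
  assumes "in_tree T root"
    and "\<And>e. e \<in> arcs T \<Longrightarrow> w e > 0"
  shows "in_tree.sync_delay T root w =
    (MAX p\<in>in_tree.leaf_root_paths T root. \<Sum>e\<leftarrow>p. w e)"
  using assms(1) by (rule in_tree.sync_delay_eq_Max_leaf_root_paths)

end
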